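(* Let $\mathcal{B}$ be a Banach space, let $\Gamma$ be the complete graph with $d+1$ vertices, and let $\rho:[0,\infty)\to[0,1]$ be a nonincreasing function such that $\rho(s_2)\le\frac{s_1}{s_2}\,\rho(s_1)$ for all $1\le s_1<s_2$, and such that there is some constant $C$ with $s\,|\rho'(s)|\le C\,\rho(s)$ for all $s\ge1$. Given $\lambda>1$, there exist $\Lambda_0,\kappa>1$ so that if $u:\Gamma\to\mathcal{B}$, $\Gamma_0\subset\Gamma$, $|\Gamma_0|>2$, $\Gamma_0$ is a $\Lambda$-cluster for $u$ for some $\Lambda\ge\Lambda_0$, $\lambda\ge\|\nabla u|_{\Gamma_0}\|_\infty$ and $\mathrm{dist}_u(\Gamma_0,\Gamma\setminus\Gamma_0)\ge\Lambda_0$, then: (1) $\kappa\,\|\nabla A_u|_{\Gamma_0}\|_\infty\le\|\nabla u|_{\Gamma_0}\|_\infty$; (2) $\Gamma_0$ is a $\kappa\,\Lambda$-cluster for $A_u$.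
   Context: The time one map is $A_u:\Gamma\to\mathcal{B}$, $$A_u(v)=u(v)+\frac1d\sum_{\tilde v\ne v}[u(\tilde v)-u(v)]\,\rho(\|u(\tilde v)-u(v)\|_{\mathcal{B}}).$$ For a map $w:\Gamma\to\mathcal{B}$ and subsets $\Gamma_0,\Gamma_1\subset\Gamma$: $\mathrm{dist}_w(\Gamma_0,\Gamma_1)=\min_{v\in\Gamma_0,\,v'\in\Gamma_1}\|w(v)-w(v')\|_{\mathcal{B}}$, and $\|\nabla w|_{\Gamma_0}\|_\infty=\max_{v,v'\in\Gamma_0}\|w(v)-w(v')\|_{\mathcal{B}}$. Given $\Lambda\ge1$, a subset $\Gamma_0\subset\Gamma$ is a $\Lambda$-cluster for $w$ if $\Lambda\,\|\nabla w|_{\Gamma_0}\|_\infty<\mathrm{dist}_w(\Gamma_0,\Gamma\setminus\Gamma_0)$. The graph $\Gamma$ (hence $d$), the function $\rho$ and the constant $C$ are fixed.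
   Formalization: The formal theorem adds the hypothesis ρ(1) > 0; without it the claim is false, since for ρ = 0 one has A_u = u and (1) fails with κ > 1 for any non-constant cluster. *)

theory Defs
  imports "HOL-Analysis.Analysis"
begin

text \<open>
  The vertex set of the complete graph on \<open>d + 1\<close> vertices is a finite type \<open>'v\<close> with
  \<open>CARD('v) = d + 1\<close>. Any two distinct vertices are adjacent, so the neighbours of \<open>v\<close> are
  \<open>UNIV - {v}\<close>.
\<close>

definition time_one_map ::
  "nat \<Rightarrow> (real \<Rightarrow> real) \<Rightarrow> ('v::finite \<Rightarrow> 'b::real_normed_vector) \<Rightarrow> 'v \<Rightarrow> 'b" where
  "time_one_map d \<rho> u v =
     u v + (1 / real d) *\<^sub>R (\<Sum>v'\<in>UNIV - {v}. \<rho> (norm (u v' - u v)) *\<^sub>R (u v' - u v))"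

text \<open>
  For nonempty sets of vertices the infimum is a minimum, since the index set is finite. The extended
  reals provide the convention that the minimum over an empty set is \<open>\<infinity>\<close>, which is
  needed for \<open>\<Gamma>\<^sub>1 = - \<Gamma>\<^sub>0\<close> with \<open>\<Gamma>\<^sub>0 = UNIV\<close>.
\<close>

definition set_dist ::
  "('v::finite \<Rightarrow> 'b::real_normed_vector) \<Rightarrow> 'v set \<Rightarrow> 'v set \<Rightarrow> ereal" where
  "set_dist w \<Gamma>\<^sub>0 \<Gamma>\<^sub>1 = (INF (v, v') \<in> \<Gamma>\<^sub>0 \<times> \<Gamma>\<^sub>1. ereal (norm (w v - w v')))"

text \<open>Only meaningful for nonempty \<open>\<Gamma>\<^sub>0\<close>.\<close>

definition grad_norm :: "('v::finite \<Rightarrow> 'b::real_normed_vector) \<Rightarrow> 'v set \<Rightarrow> real" where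
  "grad_norm w \<Gamma>\<^sub>0 = Max ((\<lambda>(v, v'). norm (w v - w v')) ` (\<Gamma>\<^sub>0 \<times> \<Gamma>\<^sub>0))"

definition is_cluster ::
  "real \<Rightarrow> ('v::finite \<Rightarrow> 'b::real_normed_vector) \<Rightarrow> 'v set \<Rightarrow> bool" where
  "is_cluster \<Lambda> w \<Gamma>\<^sub>0 \<longleftrightarrow>
     1 \<le> \<Lambda> \<and> ereal (\<Lambda> * grad_norm w \<Gamma>\<^sub>0) < set_dist w \<Gamma>\<^sub>0 (- \<Gamma>\<^sub>0)"

end

theory Submission
  imports Defs
begin

text \<open>
  On the cluster, the part of the time one map that comes from the vertices of the cluster replaces
  each value \<open>u v\<close> by a convex combination of the values on the cluster. When \<open>\<Gamma>\<^sub>0\<close> has a third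
  vertex, the two convex combinations belonging to any two vertices share a weight at least
  \<open>\<rho> lam / d\<close>, so that diameters shrink by the factor \<open>1 - \<rho> lam / d\<close>. This weight is positive
  because the bound on \<open>\<rho>'\<close> makes \<open>s\<^sup>C \<rho> s\<close> nondecreasing. The remote vertices act on the cluster
  through \<open>z \<mapsto> \<rho> \<parallel>z\<parallel> z\<close>, whose Lipschitz constant outside the ball of radius \<open>R\<close> is
  \<open>O(\<rho> R) = O(1 / R)\<close>; they perturb the contraction by an arbitrarily small amount. Finally no vertex
  moves by more than 1, since \<open>s \<rho> s \<le> 1\<close>, so that the distance to the complement decreases only
  by a factor close to 1.
\<close>

section \<open>Diameters, distances and convex combinations over finite vertex sets\<close>

lemma norm_le_grad_norm:
  fixes w :: "'v::finite \<Rightarrow> 'b::real_normed_vector"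
  assumes "a \<in> S" "b \<in> S"
  shows "norm (w a - w b) \<le> grad_norm w S"
  unfolding grad_norm_def using assms by (intro Max_ge) (auto intro!: image_eqI[where x = "(a, b)"])

lemma grad_norm_le:
  fixes w :: "'v::finite \<Rightarrow> 'b::real_normed_vector"
  assumes "S \<noteq> {}" and "\<And>a b. a \<in> S \<Longrightarrow> b \<in> S \<Longrightarrow> norm (w a - w b) \<le> c"
  shows "grad_norm w S \<le> c"
  unfolding grad_norm_def using assms by (subst Max_le_iff) auto

text \<open>Strictness survives the infimum because there are finitely many pairs, so that it is a
  minimum. If one of the sets is empty, the infimum is \<infinity> and both sides hold; this covers
  a cluster with empty complement.\<close>

lemma less_set_dist_iff:
  fixes w :: "'v::finite \<Rightarrow> 'b::real_normed_vector"
  shows "ereal r < set_dist w S T \<longleftrightarrow> (\<forall>a\<in>S. \<forall>b\<in>T. r < norm (w a - w b))"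
proof (cases "S \<times> T = {}")
  case True
  then show ?thesis by (auto simp: set_dist_def top_ereal_def)
next
  case False
  then have "set_dist w S T = Min ((\<lambda>(a, b). ereal (norm (w a - w b))) ` (S \<times> T))"
    unfolding set_dist_def by (subst Min_Inf) auto
  with False show ?thesis
    by (simp add: Min_gr_iff split: prod.splits)
qed

lemma le_set_dist_iff:
  fixes w :: "'v::finite \<Rightarrow> 'b::real_normed_vector"
  shows "ereal r \<le> set_dist w S T \<longleftrightarrow> (\<forall>a\<in>S. \<forall>b\<in>T. r \<le> norm (w a - w b))"
  by (auto simp: set_dist_def le_INF_iff)

text \<open>Coupling \<open>p\<close> and \<open>q\<close> by the product weights
  \<open>p i * q j\<close> writes \<open>t\<close> times the difference as a double sum of the
  vectors \<open>f i - f j\<close>, of total weight \<open>t * t\<close>. In the application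
  \<open>t\<close> is the mass left after a common part of two probability weights has been removed,
  so that the factor \<open>t\<close> is the contraction.\<close>

lemma norm_weighted_sum_diff_le:
  fixes f :: "'i \<Rightarrow> 'b::real_normed_vector" and p q :: "'i \<Rightarrow> real"
  assumes S: "finite S"
    and p: "\<And>i. i \<in> S \<Longrightarrow> 0 \<le> p i" "sum p S = t"
    and q: "\<And>i. i \<in> S \<Longrightarrow> 0 \<le> q i" "sum q S = t"
    and D: "\<And>i j. i \<in> S \<Longrightarrow> j \<in> S \<Longrightarrow> norm (f i - f j) \<le> D"
  shows "norm ((\<Sum>i\<in>S. p i *\<^sub>R f i) - (\<Sum>i\<in>S. q i *\<^sub>R f i)) \<le> t * D"
proof (cases "t = 0")
  case True
  then have "\<And>i. i \<in> S \<Longrightarrow> p i = 0" "\<And>i. i \<in> S \<Longrightarrow> q i = 0"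
    using S p q by (simp_all add: sum_nonneg_eq_0_iff)
  with True show ?thesis by simp
next
  case False
  then have t: "0 < t" using p sum_nonneg[of S p] by fastforce
  let ?E = "(\<Sum>i\<in>S. p i *\<^sub>R f i) - (\<Sum>i\<in>S. q i *\<^sub>R f i)"
  have 1: "(\<Sum>i\<in>S. \<Sum>j\<in>S. (p i * q j) *\<^sub>R f i) = t *\<^sub>R (\<Sum>i\<in>S. p i *\<^sub>R f i)"
    by (simp add: scaleR_sum_left[symmetric] sum_distrib_left[symmetric] q(2) scaleR_sum_right mult.commute)
  have "(\<Sum>i\<in>S. \<Sum>j\<in>S. (p i * q j) *\<^sub>R f j) = (\<Sum>j\<in>S. \<Sum>i\<in>S. (p i * q j) *\<^sub>R f j)"
    by (rule sum.swap)
  then have 2: "(\<Sum>i\<in>S. \<Sum>j\<in>S. (p i * q j) *\<^sub>R f j) = t *\<^sub>R (\<Sum>j\<in>S. q j *\<^sub>R f j)"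
    by (simp add: scaleR_sum_left[symmetric] sum_distrib_right[symmetric] p(2) scaleR_sum_right)
  have "t *\<^sub>R ?E = (\<Sum>i\<in>S. \<Sum>j\<in>S. (p i * q j) *\<^sub>R (f i - f j))"
    by (simp add: scaleR_diff_right sum_subtractf 1 2)
  also have "norm \<dots> \<le> (\<Sum>i\<in>S. \<Sum>j\<in>S. (p i * q j) * D)"
    using p q D by (intro order.trans[OF norm_sum] sum_mono) (auto intro!: mult_left_mono)
  also have "\<dots> = t * (t * D)"
    by (simp add: sum_distrib_right[symmetric] sum_distrib_left[symmetric] p(2) q(2) mult.assoc)
  finally show ?thesis using t by simp
qed

text \<open>\<open>rho_pos\<close> makes explicit that \<open>\<rho>\<close> does not vanish on [1,
  \<infinity>). A kernel that did would leave fixed any configuration whose mutual distances are all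
  0 or at least 1, and no factor above 1 could be gained.\<close>

locale decaying_kernel =
  fixes \<rho> :: "real \<Rightarrow> real" and C :: real
  assumes rho_range: "\<And>s. 0 \<le> s \<Longrightarrow> 0 \<le> \<rho> s \<and> \<rho> s \<le> 1"
    and rho_nonincreasing: "antimono_on {0..} \<rho>"
    and rho_pos: "0 < \<rho> 1"
    and rho_decay: "\<And>s\<^sub>1 s\<^sub>2. 1 \<le> s\<^sub>1 \<Longrightarrow> s\<^sub>1 < s\<^sub>2 \<Longrightarrow> \<rho> s\<^sub>2 \<le> s\<^sub>1 / s\<^sub>2 * \<rho> s\<^sub>1"
    and rho_differentiable: "\<And>s. 1 \<le> s \<Longrightarrow> \<rho> differentiable (at s)"
    and rho_deriv: "\<And>s. 1 \<le> s \<Longrightarrow> s * \<bar>deriv \<rho> s\<bar> \<le> C * \<rho> s"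
begin

section \<open>Positivity, decay and regularity of the kernel\<close>

lemma rho_antimono: "0 \<le> s \<Longrightarrow> s \<le> t \<Longrightarrow> \<rho> t \<le> \<rho> s"
  using monotone_onD[OF rho_nonincreasing, of s t] by auto

lemma rho_has_deriv: "1 \<le> s \<Longrightarrow> (\<rho> has_real_derivative deriv \<rho> s) (at s)"
  using rho_differentiable DERIV_deriv_iff_real_differentiable by blast

lemma C_nonneg: "0 \<le> C"
proof -
  have "0 \<le> C * \<rho> 1" using rho_deriv[of 1] by simp
  then show ?thesis using rho_pos by (simp add: zero_le_mult_iff)
qed

lemma mult_rho_le_1:
  assumes "0 \<le> s"
  shows "s * \<rho> s \<le> 1"
proof (cases "s \<le> 1")
  case True
  then show ?thesis using assms rho_range[of s] by (simp add: mult_le_one)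
next
  case False
  then have "\<rho> s \<le> 1 / s * \<rho> 1" using rho_decay[of 1 s] by simp
  then have "s * \<rho> s \<le> \<rho> 1" using False by (simp add: field_simps)
  then show ?thesis using rho_range[of 1] by simp
qed

lemma rho_positive:
  assumes "1 \<le> s"
  shows "0 < \<rho> s"
proof -
  \<comment> \<open>The derivative of \<open>\<rho> x * x powr C\<close> is a positive multiple of
    \<open>x * deriv \<rho> x + C * \<rho> x\<close>, which \<open>rho_deriv\<close> keeps
    nonnegative.\<close>
  have "\<rho> 1 * 1 powr C \<le> \<rho> s * s powr C"
  proof (rule DERIV_nonneg_imp_nondecreasing[OF assms])
    fix x :: real assume x: "1 \<le> x" "x \<le> s"
    let ?y = "deriv \<rho> x * x powr C + \<rho> x * (C * x powr (C - 1))"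
    have "((\<lambda>x. \<rho> x * x powr C) has_real_derivative ?y) (at x)"
      using x by (auto intro!: derivative_eq_intros rho_has_deriv)
    moreover have "?y = x powr (C - 1) * (x * deriv \<rho> x + C * \<rho> x)"
      using x by (simp add: powr_diff field_simps)
    moreover have "0 \<le> x * deriv \<rho> x + C * \<rho> x"
    proof -
      have "- (x * deriv \<rho> x) \<le> x * \<bar>deriv \<rho> x\<bar>"
        using x mult_left_mono[of "- deriv \<rho> x" "\<bar>deriv \<rho> x\<bar>" x] by simp
      then show ?thesis using rho_deriv[OF x(1)] by linarith
    qed
    ultimately show "\<exists>y. ((\<lambda>x. \<rho> x * x powr C) has_real_derivative y) (at x) \<and> 0 \<le> y"
      by (metis mult_nonneg_nonneg powr_ge_zero)
  qed
  then have "0 < \<rho> s * s powr C" using rho_pos by simp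
  then show ?thesis using assms by (simp add: zero_less_mult_iff)
qed

text \<open>The mean value theorem gives a point \<open>z\<close> between \<open>s\<close> and
  \<open>t\<close>. Since \<open>t \<le> 2 * s < 2 * z\<close>, the factor \<open>t\<close> costs at
  most twice the factor \<open>z\<close> that \<open>rho_deriv\<close> can absorb, and
  \<open>\<rho> z \<le> \<rho> R\<close>.\<close>

lemma rho_diff_bound:
  assumes "1 \<le> R" "R \<le> s" "s < t" "t \<le> 2 * s"
  shows "t * \<bar>\<rho> t - \<rho> s\<bar> \<le> 2 * C * \<rho> R * (t - s)"
proof -
  obtain z where z: "s < z" "z < t" "\<rho> t - \<rho> s = (t - s) * deriv \<rho> z"
    using MVT2[of s t \<rho> "deriv \<rho>"] assms rho_has_deriv by force
  have "t * \<bar>deriv \<rho> z\<bar> \<le> 2 * (z * \<bar>deriv \<rho> z\<bar>)"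
    using z assms mult_right_mono[of t "2 * z" "\<bar>deriv \<rho> z\<bar>"] by simp
  also have "\<dots> \<le> 2 * (C * \<rho> z)" using rho_deriv[of z] z assms by simp
  also have "\<dots> \<le> 2 * (C * \<rho> R)"
    using rho_antimono[of R z] z assms C_nonneg by (simp add: mult_left_mono)
  finally have "(t * \<bar>deriv \<rho> z\<bar>) * (t - s) \<le> 2 * (C * \<rho> R) * (t - s)"
    using assms by (intro mult_right_mono) auto
  moreover have "\<bar>\<rho> t - \<rho> s\<bar> = (t - s) * \<bar>deriv \<rho> z\<bar>"
    using z assms by (simp add: abs_mult)
  ultimately show ?thesis by (simp add: ac_simps)
qed

text \<open>By symmetry \<open>b\<close> may be taken as the longer vector. The change splits into a
  change of vector, with coefficient at most \<open>\<rho> R\<close>, and a change of coefficient on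
  \<open>b\<close>, handled by \<open>rho_diff_bound\<close>. The condition
  \<open>norm (a - b) \<le> R\<close> ensures \<open>norm b \<le> 2 * norm a\<close>.\<close>

lemma kernel_lipschitz:
  fixes a b :: "'b::real_normed_vector"
  assumes "1 \<le> R" "R \<le> norm a" "R \<le> norm b" "norm (a - b) \<le> R"
  shows "norm (\<rho> (norm a) *\<^sub>R a - \<rho> (norm b) *\<^sub>R b) \<le> (1 + 2 * C) * \<rho> R * norm (a - b)"
proof -
  have *: "norm (\<rho> (norm a) *\<^sub>R a - \<rho> (norm b) *\<^sub>R b) \<le> (1 + 2 * C) * \<rho> R * norm (a - b)"
    if R: "1 \<le> R" "R \<le> norm a" "norm (a - b) \<le> R" and ab: "norm a \<le> norm b" for a b :: 'b
  proof -
    have tri: "norm b - norm a \<le> norm (a - b)"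
      by (metis norm_minus_commute norm_triangle_ineq2)
    have "norm b * \<bar>\<rho> (norm b) - \<rho> (norm a)\<bar> \<le> 2 * C * \<rho> R * (norm b - norm a)"
    proof (cases "norm a = norm b")
      case False
      then show ?thesis using R ab tri by (intro rho_diff_bound) auto
    qed simp
    also have "\<dots> \<le> 2 * C * \<rho> R * norm (a - b)"
      using tri C_nonneg rho_range[of R] R by (intro mult_left_mono) auto
    finally have 1: "norm ((\<rho> (norm a) - \<rho> (norm b)) *\<^sub>R b) \<le> 2 * C * \<rho> R * norm (a - b)"
      by (simp add: mult.commute abs_minus_commute)
    have "norm (\<rho> (norm a) *\<^sub>R (a - b)) \<le> \<rho> R * norm (a - b)"
      using rho_antimono[of R "norm a"] rho_range[of "norm a"] R by (simp add: mult_right_mono)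
    moreover have "\<rho> (norm a) *\<^sub>R a - \<rho> (norm b) *\<^sub>R b =
        \<rho> (norm a) *\<^sub>R (a - b) + (\<rho> (norm a) - \<rho> (norm b)) *\<^sub>R b"
      by (simp add: algebra_simps)
    ultimately show ?thesis
      using 1 norm_triangle_ineq[of "\<rho> (norm a) *\<^sub>R (a - b)" "(\<rho> (norm a) - \<rho> (norm b)) *\<^sub>R b"]
      by (simp add: algebra_simps)
  qed
  show ?thesis
  proof (cases "norm a \<le> norm b")
    case False
    then show ?thesis using *[of b a] assms by (simp add: norm_minus_commute)
  qed (use * assms in blast)
qed

section \<open>Displacement of the vertices and splitting of the map\<close>

lemma time_one_map_displacement:
  fixes u :: "'v::finite \<Rightarrow> 'b::real_normed_vector"
  assumes "CARD('v) = d + 1"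
  shows "norm (time_one_map d \<rho> u v - u v) \<le> 1"
proof -
  have "norm (\<Sum>w\<in>UNIV - {v}. \<rho> (norm (u w - u v)) *\<^sub>R (u w - u v)) \<le> (\<Sum>w\<in>UNIV - {v}. 1)"
  proof (intro order.trans[OF norm_sum] sum_mono)
    fix w
    show "norm (\<rho> (norm (u w - u v)) *\<^sub>R (u w - u v)) \<le> 1"
      using mult_rho_le_1[of "norm (u w - u v)"] rho_range[of "norm (u w - u v)"]
      by (simp add: mult.commute)
  qed
  also have "\<dots> = real d" using assms by (simp add: card_Diff_singleton)
  finally show ?thesis
    by (cases "d = 0") (simp_all add: time_one_map_def field_simps)
qed

definition inner_map :: "nat \<Rightarrow> ('v::finite \<Rightarrow> 'b::real_normed_vector) \<Rightarrow> 'v set \<Rightarrow> 'v \<Rightarrow> 'b" where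
  "inner_map d u S v =
     u v + (1 / real d) *\<^sub>R (\<Sum>w\<in>S - {v}. \<rho> (norm (u w - u v)) *\<^sub>R (u w - u v))"

text \<open>For \<open>v\<close> in \<open>S\<close> these are the entries of a row of a stochastic
  matrix on \<open>S\<close>: the diagonal entry takes whatever mass the other vertices of
  \<open>S\<close> leave.\<close>

definition weight :: "nat \<Rightarrow> ('v::finite \<Rightarrow> 'b::real_normed_vector) \<Rightarrow> 'v set \<Rightarrow> 'v \<Rightarrow> 'v \<Rightarrow> real" where
  "weight d u S v w =
     (if w = v then 1 - (\<Sum>w'\<in>S - {v}. \<rho> (norm (u w' - u v)) / d) else \<rho> (norm (u w - u v)) / d)"

lemma time_one_map_split:
  fixes u :: "'v::finite \<Rightarrow> 'b::real_normed_vector"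
  assumes "v \<in> S"
  shows "time_one_map d \<rho> u v =
    inner_map d u S v + (1 / real d) *\<^sub>R (\<Sum>w\<in>-S. \<rho> (norm (u w - u v)) *\<^sub>R (u w - u v))"
proof -
  have "UNIV - {v} = (S - {v}) \<union> - S" using assms by auto
  moreover have "(S - {v}) \<inter> - S = {}" by auto
  ultimately show ?thesis
    unfolding time_one_map_def inner_map_def
    by (simp add: sum.union_disjoint scaleR_add_right)
qed

lemma inner_map_eq_weighted_sum:
  assumes "v \<in> S"
  shows "inner_map d u S v = (\<Sum>w\<in>S. weight d u S v w *\<^sub>R u w)"
proof -
  have "(\<Sum>w\<in>S. weight d u S v w *\<^sub>R u w) =
      weight d u S v v *\<^sub>R u v + (\<Sum>w\<in>S - {v}. weight d u S v w *\<^sub>R u w)"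
    using assms by (simp add: sum.remove)
  also have "(\<Sum>w\<in>S - {v}. weight d u S v w *\<^sub>R u w) =
      (\<Sum>w\<in>S - {v}. (\<rho> (norm (u w - u v)) / d) *\<^sub>R u w)"
    by (intro sum.cong) (auto simp: weight_def)
  finally show ?thesis
    by (simp add: inner_map_def weight_def algebra_simps sum_subtractf scaleR_sum_right
        scaleR_sum_left)
qed

text \<open>Only the diagonal entry is in question: \<open>v\<close> has at most \<open>d\<close>
  neighbours in \<open>S\<close>, and each takes at most \<open>1 / d\<close> of the mass.\<close>

lemma weight_nonneg:
  fixes u :: "'v::finite \<Rightarrow> 'b::real_normed_vector"
  assumes "v \<in> S" "CARD('v) = d + 1"
  shows "0 \<le> weight d u S v w"
proof -
  have "(\<Sum>w\<in>S - {v}. \<rho> (norm (u w - u v)) / d) \<le> (\<Sum>w\<in>S - {v}. 1 / d)"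
    using rho_range by (intro sum_mono divide_right_mono) auto
  also have "\<dots> = card (S - {v}) / d" by simp
  also have "\<dots> \<le> 1"
  proof -
    have "card (S - {v}) \<le> card (UNIV - {v})" by (intro card_mono) auto
    then have "real (card (S - {v})) \<le> real d" using assms by (simp add: card_Diff_singleton)
    then show ?thesis by (cases "d = 0") (simp_all add: divide_le_eq_1)
  qed
  finally show ?thesis using rho_range by (simp add: weight_def)
qed

lemma sum_weight:
  assumes "v \<in> S"
  shows "(\<Sum>w\<in>S. weight d u S v w) = 1"
proof -
  have "(\<Sum>w\<in>S - {v}. weight d u S v w) = (\<Sum>w\<in>S - {v}. \<rho> (norm (u w - u v)) / d)"
    by (intro sum.cong) (auto simp: weight_def)
  then show ?thesis using assms by (simp add: sum.remove weight_def)
qed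

section \<open>Contraction of a cluster\<close>

lemma inner_map_contracts:
  fixes u :: "'v::finite \<Rightarrow> 'b::real_normed_vector"
  assumes card: "CARD('v) = d + 1" "2 < card S" and v: "v \<in> S" "v' \<in> S"
    and D: "grad_norm u S \<le> r"
  shows "norm (inner_map d u S v - inner_map d u S v') \<le> (1 - \<rho> r / d) * grad_norm u S"
proof -
  \<comment> \<open>A third vertex is off the diagonal in both rows, so both rows give it weight at
    least \<open>\<rho> r / d\<close>.\<close>
  have "card {v, v'} \<le> 2" by (cases "v = v'") auto
  then obtain w where w: "w \<in> S" "w \<noteq> v" "w \<noteq> v'"
    using card(2) card_mono[of "{v, v'}" S] by (metis finite_code insertCI linorder_not_less order.trans subsetI)
  \<comment> \<open>The shared mass, concentrated at \<open>w\<close>. Removing it from both rows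
    leaves nonnegative weights of total \<open>1 - \<rho> r / d\<close>.\<close>
  define m where "m i = (if i = w then \<rho> r / d else 0)" for i
  have m: "(\<Sum>i\<in>S. m i) = \<rho> r / d" using w by (simp add: m_def)
  have mle: "m i \<le> weight d u S x i" if "x \<in> S" "w \<noteq> x" "i \<in> S" for x i
  proof (cases "i = w")
    case True
    have "norm (u w - u x) \<le> r" using norm_le_grad_norm[of w S x u] that w D by simp
    then have "\<rho> r \<le> \<rho> (norm (u w - u x))" by (intro rho_antimono) auto
    then show ?thesis using True that by (simp add: m_def weight_def divide_right_mono)
  qed (use that card weight_nonneg in \<open>auto simp: m_def\<close>)
  let ?p = "\<lambda>i. weight d u S v i - m i" and ?q = "\<lambda>i. weight d u S v' i - m i"
  have "norm ((\<Sum>i\<in>S. ?p i *\<^sub>R u i) - (\<Sum>i\<in>S. ?q i *\<^sub>R u i)) \<le> (1 - \<rho> r / d) * grad_norm u S"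
    using mle v w m by (intro norm_weighted_sum_diff_le)
      (auto simp: sum_subtractf sum_weight norm_le_grad_norm)
  then show ?thesis
    by (simp add: inner_map_eq_weighted_sum v scaleR_diff_left sum_subtractf)
qed

text \<open>An outside vertex sees \<open>v\<close> and \<open>v'\<close> along vectors of length at
  least \<open>R\<close> that differ by at most the diameter of the cluster, so
  \<open>kernel_lipschitz\<close> applies with \<open>\<rho> R \<le> 1 / R\<close>. There are at
  most \<open>d\<close> outside vertices, which the factor \<open>1 / d\<close> compensates.\<close>

lemma outer_sum_lipschitz:
  fixes u :: "'v::finite \<Rightarrow> 'b::real_normed_vector"
  assumes card: "CARD('v) = d + 1" and v: "v \<in> S" "v' \<in> S"
    and R: "1 \<le> R" "\<And>a b. a \<in> S \<Longrightarrow> b \<notin> S \<Longrightarrow> R \<le> norm (u a - u b)" "grad_norm u S \<le> R"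
  shows "norm ((1 / real d) *\<^sub>R (\<Sum>w\<in>-S. \<rho> (norm (u w - u v)) *\<^sub>R (u w - u v)) -
      (1 / real d) *\<^sub>R (\<Sum>w\<in>-S. \<rho> (norm (u w - u v')) *\<^sub>R (u w - u v'))) \<le>
    (1 + 2 * C) / R * grad_norm u S"
proof -
  let ?L = "(1 + 2 * C) / R * grad_norm u S"
  have D0: "0 \<le> grad_norm u S" using norm_le_grad_norm[OF v(1) v(1), of u] by simp
  have lip: "norm (\<rho> (norm (u w - u v)) *\<^sub>R (u w - u v) - \<rho> (norm (u w - u v')) *\<^sub>R (u w - u v')) \<le> ?L"
    if "w \<in> - S" for w
  proof -
    have le: "norm (u v' - u v) \<le> grad_norm u S" using norm_le_grad_norm v by blast
    have "norm (\<rho> (norm (u w - u v)) *\<^sub>R (u w - u v) - \<rho> (norm (u w - u v')) *\<^sub>R (u w - u v'))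
        \<le> (1 + 2 * C) * \<rho> R * norm (u v' - u v)"
      using kernel_lipschitz[of R "u w - u v" "u w - u v'"] that v R le
      by (simp add: norm_minus_commute)
    also have "\<dots> \<le> (1 + 2 * C) * (1 / R) * grad_norm u S"
      using mult_rho_le_1[of R] R le C_nonneg D0 rho_range[of R]
      by (intro mult_mono) (auto simp: field_simps)
    finally show ?thesis by simp
  qed
  have "card (- S) \<le> card (UNIV - {v})" using v by (intro card_mono) auto
  then have cS: "real (card (- S)) \<le> real d" using card by (simp add: card_Diff_singleton)
  have L0: "0 \<le> ?L" using C_nonneg R D0 by simp
  have "norm ((\<Sum>w\<in>-S. \<rho> (norm (u w - u v)) *\<^sub>R (u w - u v)) -
      (\<Sum>w\<in>-S. \<rho> (norm (u w - u v')) *\<^sub>R (u w - u v'))) \<le> (\<Sum>w\<in>-S. ?L)"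
    unfolding sum_subtractf[symmetric] using lip
    by (intro order.trans[OF norm_sum] sum_mono)
  also have "\<dots> \<le> real d * ?L" using mult_right_mono[OF cS L0] by simp
  finally show ?thesis
    unfolding scaleR_diff_right[symmetric] norm_scaleR using L0
    by (cases "d = 0") (simp_all add: divide_le_eq mult.commute)
qed

lemma cluster_contracts:
  fixes u :: "'v::finite \<Rightarrow> 'b::real_normed_vector"
  assumes card: "CARD('v) = d + 1" "2 < card S" and D: "grad_norm u S \<le> r"
    and R: "1 \<le> R" "\<And>a b. a \<in> S \<Longrightarrow> b \<notin> S \<Longrightarrow> R \<le> norm (u a - u b)" "grad_norm u S \<le> R"
  shows "grad_norm (time_one_map d \<rho> u) S \<le> (1 - \<rho> r / d + (1 + 2 * C) / R) * grad_norm u S"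
proof (rule grad_norm_le)
  show "S \<noteq> {}" using card by auto
  fix a b assume ab: "a \<in> S" "b \<in> S"
  show "norm (time_one_map d \<rho> u a - time_one_map d \<rho> u b)
      \<le> (1 - \<rho> r / d + (1 + 2 * C) / R) * grad_norm u S"
    unfolding time_one_map_split[OF ab(1)] time_one_map_split[OF ab(2)] add_diff_add distrib_right
    using inner_map_contracts[OF card ab D] outer_sum_lipschitz[OF card(1) ab R]
    by (rule norm_triangle_mono)
qed

end

theorem theorem6p9:
  fixes \<rho> :: "real \<Rightarrow> real" and C lam :: real and d :: nat
  assumes card_vertices: "CARD('v::finite) = d + 1"
    and rho_range: "\<And>s. 0 \<le> s \<Longrightarrow> 0 \<le> \<rho> s \<and> \<rho> s \<le> 1"
    and rho_nonincreasing: "antimono_on {0..} \<rho>"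
    and rho_pos: "0 < \<rho> 1"
    and rho_decay: "\<And>s\<^sub>1 s\<^sub>2. 1 \<le> s\<^sub>1 \<Longrightarrow> s\<^sub>1 < s\<^sub>2 \<Longrightarrow> \<rho> s\<^sub>2 \<le> s\<^sub>1 / s\<^sub>2 * \<rho> s\<^sub>1"
    and rho_differentiable: "\<And>s. 1 \<le> s \<Longrightarrow> \<rho> differentiable (at s)"
    and rho_deriv: "\<And>s. 1 \<le> s \<Longrightarrow> s * \<bar>deriv \<rho> s\<bar> \<le> C * \<rho> s"
    and lambda: "1 < lam"
  shows "\<exists>\<Lambda>\<^sub>0 \<kappa>. 1 < \<Lambda>\<^sub>0 \<and> 1 < \<kappa> \<and>
    (\<forall>(u :: 'v \<Rightarrow> 'b::banach) (\<Gamma>\<^sub>0 :: 'v set) (\<Lambda> :: real).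
       2 < card \<Gamma>\<^sub>0 \<longrightarrow> \<Lambda>\<^sub>0 \<le> \<Lambda> \<longrightarrow> is_cluster \<Lambda> u \<Gamma>\<^sub>0 \<longrightarrow>
       grad_norm u \<Gamma>\<^sub>0 \<le> lam \<longrightarrow> ereal \<Lambda>\<^sub>0 \<le> set_dist u \<Gamma>\<^sub>0 (- \<Gamma>\<^sub>0) \<longrightarrow>
       \<kappa> * grad_norm (time_one_map d \<rho> u) \<Gamma>\<^sub>0 \<le> grad_norm u \<Gamma>\<^sub>0 \<and>
       is_cluster (\<kappa> * \<Lambda>) (time_one_map d \<rho> u) \<Gamma>\<^sub>0)"
proof -
  interpret decaying_kernel \<rho> C
    using assms by unfold_locales auto
  \<comment> \<open>The constants precede the choice of a cluster, so \<open>d = 0\<close> is still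
    possible here; the denominator \<open>real d + 1\<close> keeps \<open>\<delta>\<close> in (0, 1]
    and below the true gain \<open>\<rho> lam / d\<close> once \<open>d\<close> is positive. With
    \<open>\<Lambda>\<^sub>0 * \<delta> = 8 + 8 * C\<close>, the outer perturbation is at most
    \<open>\<delta> / 4\<close>, and a fraction \<open>\<delta> / 4\<close> of any distance to the
    complement is at least 2.\<close>
  define \<delta> where "\<delta> = \<rho> lam / (real d + 1)"
  define \<Lambda>\<^sub>0 where "\<Lambda>\<^sub>0 = 4 * (2 + 2 * C) / \<delta>"
  define \<kappa> where "\<kappa> = 1 + \<delta> / 4"
  have \<delta>: "0 < \<delta>" "\<delta> \<le> 1"
    using rho_positive[of lam] rho_range[of lam] lambda
    by (auto simp: \<delta>_def divide_le_eq)
  have "8 * \<delta> \<le> 8 + 8 * C" using \<delta> C_nonneg by simp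
  then have \<Lambda>\<^sub>0: "8 \<le> \<Lambda>\<^sub>0" unfolding \<Lambda>\<^sub>0_def using \<delta> by (simp add: le_divide_eq)
  have \<Lambda>\<^sub>0\<delta>: "\<Lambda>\<^sub>0 * \<delta> = 8 + 8 * C" using \<delta> by (simp add: \<Lambda>\<^sub>0_def)
  show ?thesis
  proof (rule exI[of _ \<Lambda>\<^sub>0], rule exI[of _ \<kappa>], intro conjI allI impI)
    show "1 < \<Lambda>\<^sub>0" using \<Lambda>\<^sub>0 by simp
    show "1 < \<kappa>" using \<delta> by (simp add: \<kappa>_def)
    fix u :: "'v \<Rightarrow> 'b" and S :: "'v set" and \<Lambda> :: real
    assume S: "2 < card S" and \<Lambda>: "\<Lambda>\<^sub>0 \<le> \<Lambda>" and clus: "is_cluster \<Lambda> u S"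
      and D: "grad_norm u S \<le> lam" and dist: "ereal \<Lambda>\<^sub>0 \<le> set_dist u S (- S)"
    let ?A = "time_one_map d \<rho> u"
    obtain x where x: "x \<in> S" using S by fastforce
    have D0: "0 \<le> grad_norm u S" using norm_le_grad_norm[OF x x, of u] by simp
    have far: "\<Lambda>\<^sub>0 \<le> norm (u a - u b)" "\<Lambda> * grad_norm u S < norm (u a - u b)"
      if "a \<in> S" "b \<notin> S" for a b
      using that dist clus by (auto simp: is_cluster_def le_set_dist_iff less_set_dist_iff)
    \<comment> \<open>\<open>R\<close> has to be at least the diameter and at most the distance to
      the complement. The maximum qualifies, because the cluster condition with
      \<open>\<Lambda> \<ge> 1\<close> puts the complement farther away than the diameter.\<close>
    define R where "R = max \<Lambda>\<^sub>0 (grad_norm u S)"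
    have R: "\<Lambda>\<^sub>0 \<le> R" "1 \<le> R" "grad_norm u S \<le> R" using \<Lambda>\<^sub>0 by (auto simp: R_def)
    have "grad_norm u S \<le> norm (u a - u b)" if "a \<in> S" "b \<notin> S" for a b
    proof -
      have "1 * grad_norm u S \<le> \<Lambda> * grad_norm u S"
        using D0 \<Lambda> \<Lambda>\<^sub>0 by (intro mult_right_mono) auto
      then show ?thesis using far(2)[OF that] by simp
    qed
    then have "R \<le> norm (u a - u b)" if "a \<in> S" "b \<notin> S" for a b
      using that far(1) by (simp add: R_def)
    then have gA: "grad_norm ?A S \<le> (1 - \<rho> lam / d + (1 + 2 * C) / R) * grad_norm u S"
      using cluster_contracts[OF card_vertices S D R(2) _ R(3)] by blast
    have "card S \<le> CARD('v)" by (intro card_mono) auto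
    then have d: "0 < d" using S card_vertices by simp
    have "\<delta> \<le> \<rho> lam / d"
      unfolding \<delta>_def using d rho_range[of lam] lambda by (intro divide_left_mono) auto
    moreover have "(1 + 2 * C) / R \<le> \<delta> / 4"
    proof -
      have "\<Lambda>\<^sub>0 * \<delta> \<le> R * \<delta>" using R \<delta> by simp
      then show ?thesis using \<Lambda>\<^sub>0\<delta> R by (simp add: field_simps)
    qed
    ultimately have "(1 - \<rho> lam / d + (1 + 2 * C) / R) * grad_norm u S
        \<le> (1 - 3 * \<delta> / 4) * grad_norm u S"
      using D0 by (intro mult_right_mono) linarith+
    with gA have "grad_norm ?A S \<le> (1 - 3 * \<delta> / 4) * grad_norm u S" by simp
    then have "\<kappa> * grad_norm ?A S \<le> \<kappa> * ((1 - 3 * \<delta> / 4) * grad_norm u S)"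
      using \<delta> by (simp add: \<kappa>_def)
    also have "\<dots> = (\<kappa> * (1 - 3 * \<delta> / 4)) * grad_norm u S" by simp
    also have "\<dots> \<le> (1 - \<delta> / 4) * grad_norm u S"
    proof (rule mult_right_mono[OF _ D0])
      have "\<kappa> * (1 - 3 * \<delta> / 4) = 1 - \<delta> / 2 - 3 * (\<delta> * \<delta>) / 16"
        by (simp add: \<kappa>_def algebra_simps)
      then show "\<kappa> * (1 - 3 * \<delta> / 4) \<le> 1 - \<delta> / 4" using \<delta> zero_le_square[of \<delta>] by linarith
    qed
    \<comment> \<open>The first conclusion needs only the factor 1; the spare
      \<open>\<delta> / 4\<close> pays for the motion of the vertices in the second.\<close>
    finally have \<kappa>A: "\<kappa> * grad_norm ?A S \<le> (1 - \<delta> / 4) * grad_norm u S" .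
    have "(1 - \<delta> / 4) * grad_norm u S \<le> 1 * grad_norm u S"
      using \<delta> D0 by (intro mult_right_mono) auto
    then show "\<kappa> * grad_norm ?A S \<le> grad_norm u S" using \<kappa>A by simp
    have "\<kappa> * \<Lambda> * grad_norm ?A S < norm (?A a - ?A b)" if ab: "a \<in> S" "b \<notin> S" for a b
    proof -
      have "\<kappa> * \<Lambda> * grad_norm ?A S = \<Lambda> * (\<kappa> * grad_norm ?A S)" by simp
      also have "\<dots> \<le> \<Lambda> * ((1 - \<delta> / 4) * grad_norm u S)"
        using \<kappa>A \<Lambda> \<Lambda>\<^sub>0 by (intro mult_left_mono) auto
      also have "\<dots> = (1 - \<delta> / 4) * (\<Lambda> * grad_norm u S)" by simp
      also have "\<dots> < (1 - \<delta> / 4) * norm (u a - u b)"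
        using far(2)[OF ab] \<delta> by (intro mult_strict_left_mono) auto
      \<comment> \<open>The 2 is the largest possible loss of distance, as \<open>a\<close> and
        \<open>b\<close> each move by at most 1.\<close>
      also have "\<dots> \<le> norm (u a - u b) - 2"
      proof -
        have "\<Lambda>\<^sub>0 * \<delta> \<le> norm (u a - u b) * \<delta>" using far(1)[OF ab] \<delta> by (intro mult_right_mono) auto
        then show ?thesis using \<Lambda>\<^sub>0\<delta> C_nonneg by (simp add: algebra_simps)
      qed
      also have "\<dots> \<le> norm (?A a - ?A b)"
      proof -
        have "norm (u a - u b) \<le> norm (?A a - ?A b) + (norm (?A b - u b) + norm (?A a - u a))"
          using norm_triangle_ineq4[of "?A a - ?A b + (?A b - u b)" "?A a - u a"]
            norm_triangle_ineq[of "?A a - ?A b" "?A b - u b"]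
          by (simp add: norm_minus_commute)
        then show ?thesis
          using time_one_map_displacement[OF card_vertices, of u a]
            time_one_map_displacement[OF card_vertices, of u b] by linarith
      qed
      finally show ?thesis .
    qed
    moreover have "1 \<le> \<kappa> * \<Lambda>"
      using mult_mono[of 1 \<kappa> 1 \<Lambda>] \<delta> \<Lambda> \<Lambda>\<^sub>0 by (simp add: \<kappa>_def)
    ultimately show "is_cluster (\<kappa> * \<Lambda>) ?A S"
      unfolding is_cluster_def less_set_dist_iff by simp
  qed
qed

end
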